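(* Let $p\ge 5$ be a prime and let $n:=2^{p-1}$. Let $\phi_k(n)$, for even $k$ with $0\le k\le\lfloor n/2\rfloor$, be the numbers generated by the relation $$\frac{\phi_k(n)}{\phi_{k-2}(n)}=-\frac{n^2-(2k-4)^2}{k(k-1)}\qquad (2\le k\le \lfloor n/2\rfloor,\ k\text{ even})$$ from either one of the values $$\phi_0(n)=2\qquad\text{or}\qquad \phi_{\lfloor n/2\rfloor}(n)=4^{\lfloor n/2\rfloor}$$ (either choice may be used; both generate the same numbers $\phi_k(n)$). Then $2^p-1$ is prime if and only if $$2n-1\ \Big|\ \sum_{\substack{0\le k\le \lfloor n/2\rfloor\\ k\text{ even}}}\phi_k(n).$$
   Context: The numbers $\phi_k(n)$ are in fact integers, and divisibility is divisibility of integers. Here $\lfloor n/2\rfloor=2^{p-2}$ is even. *)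

theory Defs
  imports Complex_Main "HOL-Computational_Algebra.Primes"
begin

definition phi_indices :: "nat \<Rightarrow> nat set" where
  "phi_indices n = {k. even k \<and> k \<le> n div 2}"

(* The right-hand side never vanishes in the given range, since 0 \<le> 2k - 4 < n there.  With the
   convention x / 0 = 0 the relation therefore forces all the terms involved to be nonzero.
   Values of phi outside phi_indices n are irrelevant. *)
definition phi_relation :: "nat \<Rightarrow> (nat \<Rightarrow> rat) \<Rightarrow> bool" where
  "phi_relation n \<phi> \<longleftrightarrow>
     (\<forall>k\<in>phi_indices n. 2 \<le> k \<longrightarrow>
        \<phi> k / \<phi> (k - 2) =
          - (((of_nat n)\<^sup>2 - (2 * of_nat k - 4)\<^sup>2) / (of_nat k * (of_nat k - 1))))"

(* The relation can be started from any nonzero value at any admissible index; in particular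
   it has solutions with either of the prescribed starting values. *)
lemma phi_relation_exists:
  assumes m: "m \<in> phi_indices n" and a: "a \<noteq> 0"
  shows "\<exists>\<phi>. phi_relation n \<phi> \<and> \<phi> m = a"
proof -
  define r :: "nat \<Rightarrow> rat" where
    "r k = - (((of_nat n)\<^sup>2 - (2 * of_nat k - 4)\<^sup>2) / (of_nat k * (of_nat k - 1)))" for k
  define P where "P k = (\<Prod>j\<in>{1..k div 2}. r (2 * j))" for k
  have r: "r k \<noteq> 0" if "2 \<le> k" "k \<le> n div 2" for k
  proof -
    have eq: "(2 * of_nat k - 4 :: rat) = of_nat (2 * k - 4)"
      using that by simp
    have "(2 * k - 4)\<^sup>2 < n\<^sup>2"
      using that by (intro power_strict_mono) auto
    then have "(of_nat (2 * k - 4))\<^sup>2 < (of_nat n :: rat)\<^sup>2"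
      unfolding of_nat_power[symmetric] of_nat_less_iff .
    then have "(of_nat n)\<^sup>2 - (2 * of_nat k - 4)\<^sup>2 \<noteq> (0 :: rat)"
      unfolding eq by linarith
    moreover have "(of_nat k :: rat) \<noteq> 1" "(of_nat k :: rat) \<noteq> 0"
      using that by auto
    ultimately show ?thesis
      unfolding r_def by simp
  qed
  have P: "P k \<noteq> 0" if "k \<le> n div 2" for k
  proof -
    have "r (2 * j) \<noteq> 0" if "j \<in> {1..k div 2}" for j
      using that \<open>k \<le> n div 2\<close> by (intro r) auto
    then show ?thesis unfolding P_def by (simp add: prod_zero_iff)
  qed
  have step: "P k = P (k - 2) * r k" if "k \<in> phi_indices n" "2 \<le> k" for k
  proof -
    define j where "j = k div 2 - 1"
    have "even k" using that by (simp add: phi_indices_def)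
    then have "k = 2 * Suc j" using \<open>2 \<le> k\<close> unfolding j_def by presburger
    then show ?thesis by (simp add: P_def)
  qed
  have Pm: "P m \<noteq> 0"
    using m by (intro P) (simp add: phi_indices_def)
  have "phi_relation n (\<lambda>k. a * P k / P m)"
    unfolding phi_relation_def r_def[symmetric]
  proof (intro ballI impI)
    fix k assume k: "k \<in> phi_indices n" "2 \<le> k"
    then have "P (k - 2) \<noteq> 0"
      by (intro P) (auto simp: phi_indices_def intro: order.trans[OF diff_le_self])
    then show "a * P k / P m / (a * P (k - 2) / P m) = r k"
      unfolding step[OF k] using a Pm by simp
  qed
  then show ?thesis
    using Pm by (intro exI[of _ "\<lambda>k. a * P k / P m"] conjI) simp_all
qed

end

theory Submission
  imports Defs "HOL-Number_Theory.Quadratic_Reciprocity"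
begin

text \<open>
Write \<open>n = 4 m\<close>, so that \<open>m = 2 ^ (p - 3)\<close> is even, and put \<open>k = 2 j\<close>. The
relation becomes the hypergeometric one satisfied by the coefficients of a Chebyshev polynomial:
the value \<open>\<phi> (2 j)\<close> is the coefficient of \<open>t ^ j\<close> in \<open>2 T\<^sub>m(1 - 8 t)\<close>. These coefficients
are integers, the one of \<open>t ^ 0\<close> is \<open>2\<close> and the one of \<open>t ^ m\<close> is
\<open>(-16) ^ m = 4 ^ (n div 2)\<close>; since the relation determines \<open>\<phi>\<close> up to a scalar factor, either
prescribed value forces the other (\<open>phi_relation_imp_phi_coeff\<close>, \<open>phi_coeff_top\<close>).

The sum of all coefficients is the value at \<open>t = 1\<close>, namely
\<open>2 T\<^sub>m(-7) = 2 T\<^sub>m(7)\<close>. As \<open>7 = T\<^sub>2(2)\<close>, it equals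
\<open>2 T\<^sub>2\<^sub>m(2) = w ^ (2 m) + w' ^ (2 m)\<close> with \<open>w = 2 + \<surd>3\<close> and
\<open>w' = 2 - \<surd>3\<close> (\<open>sum_phi_coeff_zsqrt3\<close>). Here \<open>2 m = 2 ^ (p - 2)\<close>, so the sum is the term
of the Lucas-Lehmer sequence \<open>4, 14, 194, \<dots>\<close> that decides whether the Mersenne number
\<open>M = 2 ^ p - 1 = 2 n - 1\<close> is prime (\<open>lucas_lehmer\<close>).

Since \<open>w w' = 1\<close>, the number \<open>M\<close> divides that term if and only if
\<open>w ^ (2 ^ (p - 1)) \<equiv> -1\<close> modulo \<open>M\<close> in the ring \<open>\<int>[\<surd>3]\<close>. If \<open>M\<close> is prime, this congruence
follows from \<open>2 w = (1 + \<surd>3)\<^sup>2\<close> and the Frobenius map, because \<open>3\<close> is a non-residue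
and \<open>2\<close> a residue modulo \<open>M\<close> (\<open>mersenne_prime_imp_dvd\<close>). Conversely, the congruence gives
\<open>w\<close> the order \<open>2 ^ p = M + 1\<close> modulo each prime factor \<open>q\<close> of \<open>M\<close>, whereas
\<open>\<int>[\<surd>3]\<close> has only \<open>q\<^sup>2\<close> residue classes modulo \<open>q\<close>, so \<open>q\<^sup>2 > M\<close>
(\<open>dvd_imp_mersenne_prime\<close>).
\<close>


section \<open>The ring of integers with a square root of 3 adjoined\<close>

text \<open>The elements \<open>r + s \<surd>3\<close> are kept as pairs \<open>(r, s)\<close> of integers rather than as real numbers,
so that divisibility in this ring is the \<open>dvd\<close> of a type and is visible in the two components.\<close>
codatatype zsqrt3 = Zsqrt3 (rat_part: int) (irr_part: int)

lemma zsqrt3_eq_iff: "x = y \<longleftrightarrow> rat_part x = rat_part y \<and> irr_part x = irr_part y"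
  by (auto intro: zsqrt3.expand)

instantiation zsqrt3 :: comm_ring_1
begin

primcorec zero_zsqrt3 where
  "rat_part 0 = 0"
| "irr_part 0 = 0"

primcorec one_zsqrt3 where
  "rat_part 1 = 1"
| "irr_part 1 = 0"

primcorec plus_zsqrt3 where
  "rat_part (x + y) = rat_part x + rat_part y"
| "irr_part (x + y) = irr_part x + irr_part y"

primcorec uminus_zsqrt3 where
  "rat_part (- x) = - rat_part x"
| "irr_part (- x) = - irr_part x"

primcorec minus_zsqrt3 where
  "rat_part (x - y) = rat_part x - rat_part y"
| "irr_part (x - y) = irr_part x - irr_part y"

primcorec times_zsqrt3 where
  "rat_part (x * y) = rat_part x * rat_part y + 3 * irr_part x * irr_part y"
| "irr_part (x * y) = rat_part x * irr_part y + irr_part x * rat_part y"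

instance
  by standard (simp_all add: zsqrt3_eq_iff algebra_simps)

end

lemma parts_of_nat [simp]: "rat_part (of_nat k) = int k" "irr_part (of_nat k) = 0"
  by (induction k) simp_all

lemma parts_of_int [simp]: "rat_part (of_int k) = k" "irr_part (of_int k) = 0"
  by (cases k; simp)+

lemma two_parts: "rat_part 2 = 2" "irr_part 2 = 0"
  using parts_of_int[of 2] by simp_all

text \<open>Divisibility by a rational integer is componentwise because \<open>1\<close> and \<open>\<surd>3\<close> form a basis over
the integers.\<close>
lemma of_int_dvd_zsqrt3_iff:
  "of_int a dvd z \<longleftrightarrow> a dvd rat_part z \<and> a dvd irr_part z"
proof
  assume "of_int a dvd z"
  then obtain y where "z = of_int a * y" by (elim dvdE)
  then show "a dvd rat_part z \<and> a dvd irr_part z" by simp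
next
  assume "a dvd rat_part z \<and> a dvd irr_part z"
  then obtain r s where "rat_part z = a * r" "irr_part z = a * s" by (auto elim!: dvdE)
  then have "z = of_int a * Zsqrt3 r s" by (simp add: zsqrt3_eq_iff)
  then show "of_int a dvd z" by simp
qed

lemma of_int_dvd_of_int_zsqrt3_iff: "(of_int a :: zsqrt3) dvd of_int b \<longleftrightarrow> a dvd b"
  unfolding of_int_dvd_zsqrt3_iff parts_of_int by simp

lemma coprime_of_int_dvd_zsqrt3:
  assumes "coprime a b" "of_int a dvd of_int b * (z :: zsqrt3)"
  shows "of_int a dvd z"
  using assms unfolding of_int_dvd_zsqrt3_iff times_zsqrt3.simps parts_of_int
  by (simp add: coprime_dvd_mult_right_iff)

definition sqrt3 :: zsqrt3 where "sqrt3 = Zsqrt3 0 1"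

text \<open>The fundamental unit \<open>2 + \<surd>3\<close> and, below, its conjugate, which is its inverse.\<close>
definition unit_w :: zsqrt3 where "unit_w = Zsqrt3 2 1"

definition unit_w' :: zsqrt3 where "unit_w' = Zsqrt3 2 (-1)"

lemma sqrt3_square: "sqrt3 ^ 2 = of_int 3"
  unfolding zsqrt3_eq_iff parts_of_int by (simp add: sqrt3_def power2_eq_square)

lemma unit_w_mult: "unit_w * unit_w' = 1"
  by (simp add: zsqrt3_eq_iff unit_w_def unit_w'_def)

lemma unit_w_power_mult: "unit_w ^ k * unit_w' ^ k = 1"
  by (simp flip: power_mult_distrib add: unit_w_mult)

lemma two_unit_w: "of_int 2 * unit_w = (1 + sqrt3) ^ 2"
  unfolding zsqrt3_eq_iff power2_eq_square times_zsqrt3.simps parts_of_int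
  by (simp add: sqrt3_def unit_w_def)

text \<open>Congruences modulo \<open>m\<close> in a commutative ring are written as \<open>m dvd a - b\<close>; the following rules
are those for calculating with them.\<close>
lemma dvd_diff_mult:
  fixes m :: "'a::comm_ring_1"
  assumes "m dvd a - b" "m dvd c - d"
  shows "m dvd a * c - b * d"
proof -
  have "a * c - b * d = (a - b) * c + b * (c - d)" by (simp add: algebra_simps)
  then show ?thesis using assms by simp
qed

lemma dvd_diff_power:
  fixes m :: "'a::comm_ring_1"
  assumes "m dvd a - b"
  shows "m dvd a ^ k - b ^ k"
  by (induction k) (auto intro: dvd_diff_mult assms)

lemma dvd_diff_sym:
  fixes m :: "'a::comm_ring_1"
  assumes "m dvd a - b"
  shows "m dvd b - a"
  using assms by (metis dvd_minus_iff minus_diff_eq)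

lemma dvd_diff_trans:
  fixes m :: "'a::comm_ring_1"
  assumes "m dvd a - b" "m dvd b - c"
  shows "m dvd a - c"
  using dvd_add[OF assms] by simp


section \<open>The Lucas-Lehmer criterion\<close>

text \<open>The Frobenius congruence: a prime divides the inner binomial coefficients of its row. The ring need
not have prime characteristic, so the statement is a divisibility.\<close>
lemma prime_dvd_power_add:
  fixes x y :: "'a::comm_ring_1"
  assumes "prime q"
  shows "of_nat q dvd (x + y) ^ q - (x ^ q + y ^ q)"
proof -
  have "q > 0" using assms by (simp add: prime_gt_0_nat)
  have "(x + y) ^ q = (\<Sum>k\<le>q. of_nat (q choose k) * x ^ k * y ^ (q - k))"
    by (rule binomial_ring)
  also have "{..q} = insert 0 (insert q {1..<q})" using \<open>q > 0\<close> by auto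
  finally have "(x + y) ^ q - (x ^ q + y ^ q)
      = (\<Sum>k\<in>{1..<q}. of_nat (q choose k) * x ^ k * y ^ (q - k))"
    using \<open>q > 0\<close> by simp
  also have "of_nat q dvd \<dots>"
  proof (intro dvd_sum dvd_mult2)
    fix k assume "k \<in> {1..<q}"
    then have "q dvd (q choose k)" using assms by (intro dvd_choose_prime) auto
    then show "of_nat q dvd (of_nat (q choose k) :: 'a)" by (auto elim!: dvdE)
  qed
  finally show ?thesis .
qed

lemma mersenne_mod_3:
  assumes "odd p"
  shows "[2 ^ p - 1 = (1::int)] (mod 3)"
proof -
  obtain e where "p = 2 * e + 1" using assms by (elim oddE)
  then have "(2::int) ^ p - 1 - 1 = 2 * (4 ^ e - 1)" by (simp add: power_mult)
  moreover have "(3::int) dvd 4 ^ e - 1" using dvd_diff_power[of 3 "4::int" 1 e] by simp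
  ultimately show ?thesis unfolding cong_iff_dvd_diff by (metis dvd_mult)
qed

text \<open>Work modulo the prime \<open>M = 2 t + 1\<close>, where \<open>t\<close> is odd. Quadratic reciprocity turns
\<open>M \<equiv> 1\<close> modulo \<open>3\<close> and \<open>M \<equiv> 3\<close> modulo \<open>4\<close> into \<open>3 ^ t \<equiv> -1\<close>, so
\<open>(1 + \<surd>3) ^ M \<equiv> 1 + 3 ^ t \<surd>3 \<equiv> 1 - \<surd>3\<close> and hence
\<open>(1 + \<surd>3) ^ (M + 1) \<equiv> -2\<close>. On the other hand \<open>(1 + \<surd>3)\<^sup>2 = 2 w\<close>, so the same power is
\<open>2 ^ (t + 1) w ^ (t + 1)\<close>, which is congruent to \<open>2 w ^ (t + 1)\<close> because \<open>2\<close> is a square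
modulo \<open>M\<close>. Cancelling \<open>2\<close> leaves \<open>w ^ (t + 1) \<equiv> -1\<close>.\<close>
lemma mersenne_prime_imp_dvd:
  assumes "odd p" "p \<ge> 3" and M: "prime M" "M = 2 ^ p - 1"
  shows "of_int (int M) dvd unit_w ^ (2 ^ (p - 1)) + 1"
proof -
  define t :: nat where "t = 2 ^ (p - 1) - 1"
  have "(2::nat) ^ p \<ge> 2 ^ 3" using \<open>p \<ge> 3\<close> by (intro power_increasing) auto
  then have "M > 3" unfolding M by simp
  have intM: "int M = 2 ^ p - 1" unfolding M by (simp add: of_nat_diff)
  have pow: "(2::nat) ^ p = 2 * 2 ^ (p - 1)" "(2::nat) ^ (p - 1) = 2 * 2 ^ (p - 2)"
    using \<open>p \<ge> 3\<close> by (simp_all flip: power_Suc add: Suc_diff_Suc numeral_2_eq_2)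
  have "(2::nat) ^ (p - 1) \<ge> 1" by simp
  then have t: "M = 2 * t + 1" "t + 1 = 2 ^ (p - 1)"
    unfolding t_def M pow(1) by linarith+
  have half: "(M - 1) div 2 = t" using t by simp
  have "odd t" using t(2) pow(2) by (metis dvd_triv_left even_add odd_one)

  have "[3 ^ t = (-1::int)] (mod M)"
  proof -
    have "QuadRes 3 M" "\<not> [int M = 0] (mod 3)"
      using mersenne_mod_3[OF \<open>odd p\<close>] unfolding intM[symmetric] QuadRes_def
      by (auto simp: cong_def intro!: exI[of _ 1])
    then have "Legendre M 3 = 1" by (simp add: Legendre_def)
    moreover have "Legendre 3 M * Legendre M 3 = (-1) ^ ((3 - 1) div 2 * t)"
      using Quadratic_Reciprocity[of 3 M] \<open>prime M\<close> \<open>M > 3\<close> half by simp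
    ultimately have "Legendre 3 M = -1" using \<open>odd t\<close> by simp
    then show ?thesis
      using euler_criterion[of M 3] \<open>prime M\<close> \<open>M > 3\<close> half by (simp add: cong_sym)
  qed
  then have three: "of_int (int M) dvd (of_int (3 ^ t) - of_int (-1) :: zsqrt3)"
    unfolding of_int_diff[symmetric] of_int_dvd_of_int_zsqrt3_iff cong_iff_dvd_diff .

  have "[2 ^ t = (1::int)] (mod M)"
  proof -
    \<comment> \<open>A square root of \<open>2\<close>: since \<open>2 ^ p \<equiv> 1\<close>, also \<open>2 ^ (p + 1) \<equiv> 2\<close>, with an even exponent.\<close>
    have "(2 ^ ((p + 1) div 2)) ^ 2 = (2::int) ^ (p + 1)"
    proof -
      have "(p + 1) div 2 * 2 = p + 1" using \<open>odd p\<close> by presburger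
      then show ?thesis by (simp only: power_mult[symmetric])
    qed
    moreover have "(2::int) ^ (p + 1) - 2 = int M * 2" by (simp add: intM)
    ultimately have "QuadRes M 2"
      unfolding QuadRes_def cong_iff_dvd_diff by (metis dvd_triv_left)
    moreover have "\<not> [2 = 0] (mod int M)"
      using \<open>M > 3\<close> by (simp add: cong_iff_dvd_diff zdvd_not_zless)
    ultimately have "Legendre 2 M = 1" by (simp add: Legendre_def)
    then show ?thesis
      using euler_criterion[of M 2] \<open>prime M\<close> \<open>M > 3\<close> half by (simp add: cong_sym)
  qed
  then have two: "of_int (int M) dvd (of_int (2 ^ t) - of_int 1 :: zsqrt3)"
    unfolding of_int_diff[symmetric] of_int_dvd_of_int_zsqrt3_iff cong_iff_dvd_diff .

  have "sqrt3 ^ M = of_int (3 ^ t) * sqrt3"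
    by (simp add: t(1) power_mult sqrt3_square)
  moreover have "of_int (int M) dvd of_int (3 ^ t) * sqrt3 - of_int (-1) * sqrt3"
    using three by (intro dvd_diff_mult) auto
  ultimately have "of_int (int M) dvd (1 + sqrt3 ^ M) - (1 - sqrt3)" by simp
  moreover have "of_int (int M) dvd (1 + sqrt3) ^ M - (1 + sqrt3 ^ M)"
    using prime_dvd_power_add[OF \<open>prime M\<close>, of 1 sqrt3] by simp
  ultimately have "of_int (int M) dvd (1 + sqrt3) ^ M - (1 - sqrt3)"
    by (metis dvd_diff_trans)
  then have "of_int (int M) dvd (1 + sqrt3) ^ M * (1 + sqrt3) - (1 - sqrt3) * (1 + sqrt3)"
    by (rule dvd_diff_mult) simp
  moreover have "(1 - sqrt3) * (1 + sqrt3) = -2"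
    using sqrt3_square by (simp add: algebra_simps power2_eq_square)
  moreover have "(1 + sqrt3) ^ M * (1 + sqrt3) = ((1 + sqrt3) ^ 2) ^ (t + 1)"
    unfolding power_mult[symmetric] t(1) by (simp add: algebra_simps)
  moreover have "\<dots> = of_int (2 ^ t) * (2 * unit_w ^ (t + 1))"
    unfolding two_unit_w[symmetric] by (simp add: power_mult_distrib algebra_simps)
  ultimately have "of_int (int M) dvd of_int (2 ^ t) * (2 * unit_w ^ (t + 1)) + 2" by simp
  moreover have "of_int (int M) dvd
      1 * (2 * unit_w ^ (t + 1)) - of_int (2 ^ t) * (2 * unit_w ^ (t + 1))"
    using dvd_diff_sym[OF two] by (intro dvd_diff_mult) simp_all
  ultimately have "of_int (int M) dvd 1 * (2 * unit_w ^ (t + 1)) + 2"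
    using dvd_add by fastforce
  then have "of_int (int M) dvd of_int 2 * (unit_w ^ (t + 1) + 1)"
    by (simp add: algebra_simps)
  moreover have "coprime (int M) 2" unfolding t(1) by simp
  ultimately have "of_int (int M) dvd unit_w ^ (t + 1) + 1"
    by (rule coprime_of_int_dvd_zsqrt3[rotated])
  then show ?thesis unfolding t(2) .
qed

lemma composite_imp_small_prime_factor:
  fixes n :: nat
  assumes "n > 1" "\<not> prime n"
  obtains q where "prime q" "q dvd n" "q ^ 2 \<le> n"
proof -
  obtain a b where ab: "n = a * b" "a > 1" "b > 1"
    using assms by (auto simp: prime_nat_iff dvd_def)
      (metis Suc_lessI One_nat_def mult.right_neutral mult_0_right nat_neq_iff not_less0)
  obtain q where q: "prime q" "q dvd min a b"
    using ab prime_factor_nat[of "min a b"] by (metis min_def less_irrefl)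
  then have "q \<le> min a b" using ab by (intro dvd_imp_le) auto
  then have "q * q \<le> a * b" by (intro mult_mono) auto
  moreover have "q dvd n" using q(2) unfolding ab by (auto simp: min_def split: if_splits)
  ultimately show thesis using q(1) that ab(1) by (simp add: power2_eq_square)
qed

text \<open>If \<open>w ^ N \<equiv> -1\<close> for a power \<open>N\<close> of two, then the order of \<open>w\<close> is \<open>2 N\<close>, unless
\<open>1 \<equiv> -1\<close>. Two congruent powers give \<open>w ^ d \<equiv> 1\<close> with \<open>0 < d < 2 N\<close>. The power of two
contained in \<open>d\<close> divides \<open>N\<close>, so some multiple of \<open>d\<close> is an odd multiple \<open>N s\<close> of \<open>N\<close>,
and \<open>w ^ (N s)\<close> is congruent both to \<open>1\<close> and to \<open>-1\<close>.\<close>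
lemma congruent_unit_w_powers_imp_dvd_2:
  fixes q :: int
  assumes N: "N = 2 ^ e" and minus_one: "of_int q dvd unit_w ^ N + 1"
    and "i < j" "j < 2 * N" and same: "of_int q dvd unit_w ^ i - unit_w ^ j"
  shows "q dvd 2"
proof -
  define d where "d = j - i"
  have d: "d > 0" "d < 2 * N" "j = i + d" using assms by (auto simp: d_def)
  have "of_int q dvd (unit_w ^ i - unit_w ^ j) * unit_w' ^ i" using same by simp
  also have "(unit_w ^ i - unit_w ^ j) * unit_w' ^ i = 1 - unit_w ^ d"
    using unit_w_power_mult[of i] by (simp add: d(3) algebra_simps power_add)
  finally have one: "of_int q dvd unit_w ^ d - 1"
    by (rule dvd_diff_sym)
  obtain a s where as: "d = 2 ^ a * s" "odd s"
    by (rule multiplicity_decompose'[of d 2]) (use \<open>d > 0\<close> in auto)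
  have "2 ^ a \<le> d" using as by (cases s) auto
  then have "(2::nat) ^ a < 2 ^ Suc e" using d(2) N by simp
  then have "a \<le> e" by (simp del: power_Suc)
  then have eq: "d * 2 ^ (e - a) = N * s" unfolding as N by (simp flip: power_add)
  have "of_int q dvd (unit_w ^ d) ^ (2 ^ (e - a)) - 1 ^ (2 ^ (e - a))"
    using one by (rule dvd_diff_power)
  then have "of_int q dvd unit_w ^ (N * s) - 1" by (simp flip: power_mult add: eq)
  moreover have "of_int q dvd (unit_w ^ N) ^ s - (-1) ^ s"
    using minus_one by (intro dvd_diff_power) simp
  then have "of_int q dvd unit_w ^ (N * s) + 1" using as by (simp add: power_mult)
  ultimately have "of_int q dvd (unit_w ^ (N * s) + 1) - (unit_w ^ (N * s) - 1)"
    by (rule dvd_diff[rotated])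
  then have "of_int q dvd (of_int 2 :: zsqrt3)" by simp
  then show ?thesis unfolding of_int_dvd_of_int_zsqrt3_iff .
qed

text \<open>A composite \<open>M\<close> has a prime factor \<open>q\<close> with \<open>q\<^sup>2 \<le> M < 2 ^ p\<close>, so two of the first
\<open>2 ^ p\<close> powers of \<open>w\<close> fall into the same one of the \<open>q\<^sup>2\<close> residue classes modulo
\<open>q\<close>. By the previous lemma \<open>q\<close> would have to be \<open>2\<close>, but \<open>M\<close> is odd.\<close>
lemma dvd_imp_mersenne_prime:
  assumes "p \<ge> 2" and M: "M = 2 ^ p - 1"
    and dvd: "of_int (int M) dvd unit_w ^ (2 ^ (p - 1)) + 1"
  shows "prime M"
proof (rule ccontr)
  assume "\<not> prime M"
  have "(2::nat) ^ p \<ge> 2 ^ 2" using \<open>p \<ge> 2\<close> by (intro power_increasing) auto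
  then have "M > 1" unfolding M by simp
  have pow: "(2::nat) ^ p = 2 * 2 ^ (p - 1)" using \<open>p \<ge> 2\<close> by (simp flip: power_Suc)
  obtain q where q: "prime q" "q dvd M" "q ^ 2 \<le> M"
    using composite_imp_small_prime_factor[OF \<open>M > 1\<close> \<open>\<not> prime M\<close>] .
  have "q > 0" using q(1) by (simp add: prime_gt_0_nat)
  define f where "f i = (rat_part (unit_w ^ i) mod q, irr_part (unit_w ^ i) mod q)" for i :: nat
  have "f ` {..<2 ^ p} \<subseteq> {0..<int q} \<times> {0..<int q}"
    using \<open>q > 0\<close> by (auto simp: f_def)
  then have "card (f ` {..<2 ^ p}) \<le> q ^ 2"
    using card_mono[of "{0..<int q} \<times> {0..<int q}"] by (auto simp: power2_eq_square)
  also have "\<dots> < card {..<(2::nat) ^ p}" using q(3) \<open>M > 1\<close> unfolding M by simp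
  finally have "\<not> inj_on f {..<2 ^ p}" by (rule pigeonhole)
  then obtain i j where ij: "i < j" "j < 2 * 2 ^ (p - 1)" "f i = f j"
    unfolding inj_on_def pow by (metis lessThan_iff nat_neq_iff)
  have "of_int (int q) dvd unit_w ^ i - unit_w ^ j"
    using ij(3) unfolding of_int_dvd_zsqrt3_iff by (simp add: f_def mod_eq_dvd_iff)
  moreover have "of_int (int q) dvd unit_w ^ (2 ^ (p - 1)) + 1"
    using dvd q(2) unfolding of_int_dvd_zsqrt3_iff
    by (meson dvd_trans int_dvd_int_iff)
  ultimately have "int q dvd 2"
    using congruent_unit_w_powers_imp_dvd_2[OF refl _ ij(1,2)] by blast
  then have "q dvd 2" by presburger
  then have "q = 2" using q(1) by (simp add: primes_dvd_imp_eq)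
  then show False using q(2) \<open>M > 1\<close> unfolding M pow by presburger
qed

text \<open>Multiplying \<open>w ^ N + w' ^ N\<close> by the unit \<open>w ^ N\<close> gives \<open>w ^ (2 N) + 1\<close>. For
\<open>N = 2 ^ (p - 2)\<close> the sum is the term with index \<open>p - 2\<close> of the sequence that starts with \<open>4\<close> and
continues by \<open>s \<mapsto> s\<^sup>2 - 2\<close>.\<close>
theorem lucas_lehmer:
  assumes "odd p" "p \<ge> 3"
  shows "prime (2 ^ p - 1 :: nat) \<longleftrightarrow>
    (of_int (2 ^ p - 1) :: zsqrt3) dvd unit_w ^ (2 ^ (p - 2)) + unit_w' ^ (2 ^ (p - 2))"
proof -
  define N :: nat where "N = 2 ^ (p - 2)"
  have double: "N + N = 2 ^ (p - 1)"
    using \<open>p \<ge> 3\<close> unfolding N_def by (simp flip: power_Suc mult_2 add: Suc_diff_Suc numeral_2_eq_2)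
  have "unit_w ^ N * (unit_w ^ N + unit_w' ^ N) = unit_w ^ (2 ^ (p - 1)) + 1"
    unfolding double[symmetric] by (simp add: distrib_left power_add unit_w_power_mult)
  then have "m dvd unit_w ^ N + unit_w' ^ N \<longleftrightarrow> m dvd unit_w ^ (2 ^ (p - 1)) + 1" for m
    by (metis dvd_mult dvd_mult_left mult.assoc mult.commute mult.left_neutral unit_w_power_mult)
  moreover have "int (2 ^ p - 1) = 2 ^ p - 1" by (simp add: of_nat_diff)
  ultimately show ?thesis
    using mersenne_prime_imp_dvd[OF assms _ refl] dvd_imp_mersenne_prime[OF _ refl, of p] \<open>p \<ge> 3\<close>
    unfolding N_def by (metis Suc_leD eval_nat_numeral(3))
qed


section \<open>Morgan-Voyce polynomials as power sums\<close>

text \<open>The Morgan-Voyce polynomial \<open>b\<^sub>m\<close>. The coefficients of \<open>2 T\<^sub>m(1 + x / 2)\<close> are sums of two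
binomial coefficients, and accordingly \<open>2 T\<^sub>m(1 + x / 2) = b\<^sub>m(x) + b\<^sub>m\<^sub>-\<^sub>1(x)\<close>. The ring is
arbitrary because the value at the integer \<open>-16\<close> is also needed in \<open>\<int>[\<surd>3]\<close>.\<close>
definition morgan_voyce :: "'a::comm_ring_1 \<Rightarrow> nat \<Rightarrow> 'a" where
  "morgan_voyce x m = (\<Sum>j\<le>m. of_nat ((m + j) choose (2 * j)) * x ^ j)"

text \<open>The binomial coefficients vanish beyond \<open>j = m\<close>, so neighbouring polynomials can be summed over a
common range.\<close>
lemma morgan_voyce_extend:
  assumes "m \<le> N"
  shows "morgan_voyce x m = (\<Sum>j\<le>N. of_nat ((m + j) choose (2 * j)) * x ^ j)"
  unfolding morgan_voyce_def
proof (rule sum.mono_neutral_left)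
  show "\<forall>j\<in>{..N} - {..m}. of_nat ((m + j) choose (2 * j)) * x ^ j = 0"
    by (simp add: binomial_eq_0)
qed (use assms in auto)

lemma morgan_voyce_0_1 [simp]:
  "morgan_voyce x 0 = 1" "morgan_voyce x (Suc 0) = 1 + x"
  by (simp_all add: morgan_voyce_def eval_nat_numeral)

lemma of_int_morgan_voyce: "of_int (morgan_voyce x m) = morgan_voyce (of_int x) m"
  by (simp add: morgan_voyce_def)

lemma binomial_second_difference:
  "(Suc (Suc N) choose (r + 2)) + (N choose (r + 2))
     = 2 * (Suc N choose (r + 2)) + (N choose r)"
  by (simp add: numeral_2_eq_2)

text \<open>Coefficientwise this is the preceding second difference, taken in the upper argument of the binomial
coefficients; the factor \<open>x\<close> accounts for the shift of \<open>j\<close> in its last term. In the proof,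
\<open>a k j\<close> is the coefficient of \<open>x ^ (j + 1)\<close> in the \<open>k\<close>-th polynomial; the constant terms are
\<open>1\<close> and are split off.\<close>
lemma morgan_voyce_rec:
  fixes x :: "'a::comm_ring_1"
  shows "morgan_voyce x (m + 2) + morgan_voyce x m = (2 + x) * morgan_voyce x (m + 1)"
proof -
  define a :: "nat \<Rightarrow> nat \<Rightarrow> 'a" where "a k j = of_nat ((k + Suc j) choose (2 * Suc j))" for k j
  define b :: "nat \<Rightarrow> 'a" where "b j = of_nat ((m + 1 + j) choose (2 * j))" for j
  have mv: "morgan_voyce x k = 1 + (\<Sum>j\<le>m + 1. a k j * x ^ Suc j)" if "k \<le> m + 2" for k
  proof -
    have "{..m + 2} = {..Suc (m + 1)}" by simp
    then show ?thesis
      unfolding morgan_voyce_extend[OF that] a_def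
      by (simp only: sum.atMost_Suc_shift) simp
  qed
  have shift: "x * morgan_voyce x (m + 1) = (\<Sum>j\<le>m + 1. b j * x ^ Suc j)"
    unfolding morgan_voyce_def b_def sum_distrib_left by (simp only: power_Suc mult_ac)
  have diff: "a (m + 2) j + a m j = 2 * a (m + 1) j + b j" for j
    using arg_cong[OF binomial_second_difference[of "m + Suc j" "2 * j"], of "of_nat :: nat \<Rightarrow> 'a"]
    by (simp add: a_def b_def del: binomial_Suc_Suc)
  have "morgan_voyce x (m + 2) + morgan_voyce x m
      = 2 + (\<Sum>j\<le>m + 1. (a (m + 2) j + a m j) * x ^ Suc j)"
    by (simp add: mv distrib_right sum.distrib del: sum.atMost_Suc add_2_eq_Suc')
  also have "\<dots> = (2 + (\<Sum>j\<le>m + 1. 2 * a (m + 1) j * x ^ Suc j)) + x * morgan_voyce x (m + 1)"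
    unfolding diff shift distrib_right sum.distrib by (simp only: add.assoc)
  also have "2 + (\<Sum>j\<le>m + 1. 2 * a (m + 1) j * x ^ Suc j) = 2 * morgan_voyce x (m + 1)"
    by (simp add: mv distrib_left sum_distrib_left mult.assoc del: sum.atMost_Suc)
  finally show ?thesis by (simp add: distrib_right)
qed

text \<open>Both sides satisfy the recurrence with characteristic polynomial \<open>X\<^sup>2 - (2 + x) X + 1\<close>, whose
roots are \<open>u\<close> and \<open>v\<close>, and they have the same initial values.\<close>
lemma morgan_voyce_add_eq_power_sum:
  fixes u v :: "'a::comm_ring_1"
  assumes prod: "u * v = 1" and sum: "u + v = 2 + x"
  shows "morgan_voyce x (m + 1) + morgan_voyce x m = u ^ (m + 1) + v ^ (m + 1)"
proof (induction m rule: induct_nat_012)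
  case 0
  show ?case using sum by simp
next
  case 1
  have "u ^ 2 + v ^ 2 = (2 + x) ^ 2 - 2"
    unfolding sum[symmetric] by (simp add: power2_sum mult.assoc prod)
  moreover have "morgan_voyce x 2 + morgan_voyce x 0 = (2 + x) * morgan_voyce x 1"
    using morgan_voyce_rec[of x 0] by (simp only: add_0)
  ultimately have "morgan_voyce x 2 + morgan_voyce x 1 = u ^ 2 + v ^ 2"
    by (simp add: algebra_simps power2_eq_square)
  then show ?case by (simp add: numeral_2_eq_2)
next
  case (ge2 m)
  have "u ^ (m + 3) + v ^ (m + 3) = (u + v) * (u ^ (m + 2) + v ^ (m + 2))
      - u * v * (u ^ (m + 1) + v ^ (m + 1))"
    by (simp add: algebra_simps power_add eval_nat_numeral)
  also have "\<dots> = (2 + x) * (morgan_voyce x (m + 2) + morgan_voyce x (m + 1))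
      - (morgan_voyce x (m + 1) + morgan_voyce x m)"
    using ge2 by (simp add: prod sum)
  also have "\<dots> = morgan_voyce x (m + 3) + morgan_voyce x (m + 2)"
  proof -
    have "morgan_voyce x (m + 3) + morgan_voyce x (m + 1) = (2 + x) * morgan_voyce x (m + 2)"
      using morgan_voyce_rec[of x "m + 1"] by (simp add: eval_nat_numeral)
    moreover have "(a3 + a1) + (a2 + a0) - (a1 + a0) = a3 + a2" for a0 a1 a2 a3 :: 'a
      by simp
    ultimately show ?thesis
      unfolding distrib_left morgan_voyce_rec[of x m, symmetric] by metis
  qed
  finally show ?case by (simp add: eval_nat_numeral)
qed


section \<open>The integers generated by the relation\<close>

text \<open>
The coefficient of \<open>t ^ j\<close> in \<open>2 T\<^sub>m(1 - 8 t)\<close> for \<open>m > 0\<close>. It is usually written as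
\<open>(-16) ^ j * 2 * m / (m + j) * ((m + j) choose (2 * j))\<close>; the form chosen here shows that it is an
integer and that the sum over \<open>j\<close> is a sum of two values of Morgan-Voyce polynomials.
\<close>
definition phi_coeff :: "nat \<Rightarrow> nat \<Rightarrow> int" where
  "phi_coeff m j = (-16) ^ j * (int ((m + j) choose (2 * j)) + int ((m + j - 1) choose (2 * j)))"

lemma sum_phi_coeff:
  "(\<Sum>j\<le>Suc m. phi_coeff (Suc m) j) = morgan_voyce (-16) (Suc m) + morgan_voyce (-16) m"
proof -
  have "morgan_voyce (-16) m = (\<Sum>j\<le>Suc m. int ((m + j) choose (2 * j)) * (-16) ^ j)"
    by (rule morgan_voyce_extend) simp
  then show ?thesis
    by (simp only: phi_coeff_def morgan_voyce_def[of _ "Suc m"])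
      (simp add: sum.distrib algebra_simps)
qed

lemma phi_coeff_0 [simp]: "phi_coeff m 0 = 2"
  by (simp add: phi_coeff_def)

text \<open>Only the first binomial coefficient is nonzero for \<open>j = m\<close>. The parity of \<open>m\<close> removes the sign.\<close>
lemma phi_coeff_top:
  assumes "m > 0" "even m"
  shows "phi_coeff m m = 16 ^ m"
  using assms by (simp add: phi_coeff_def binomial_eq_0 mult_2)

lemma binomial_lower_step:
  "(int r + 1) * int (N choose Suc r) = (int N - int r) * int (N choose r)"
proof (cases "r \<le> N")
  case True
  have "(r + 1) * (N choose Suc r) = (N - r) * (N choose r)"
    using binomial_absorption[of r N] binomial_absorb_comp[of N r] by simp
  then have "int ((r + 1) * (N choose Suc r)) = int ((N - r) * (N choose r))" by simp
  then show ?thesis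
    unfolding of_nat_mult of_nat_diff[OF True] by (simp only: of_nat_add of_nat_1)
qed (simp add: binomial_eq_0)

lemma binomial_step:
  "int ((N + 1) choose (r + 2)) * ((int r + 2) * (int r + 1))
     = (int N + 1) * (int N - int r) * int (N choose r)"
proof -
  have "(r + 2) * (Suc N choose (r + 2)) = Suc N * (N choose Suc r)"
    using binomial_absorption[of "Suc r" "Suc N"] by (simp del: binomial_Suc_Suc)
  then have "(int r + 2) * int ((N + 1) choose (r + 2)) = (int N + 1) * int (N choose Suc r)"
    unfolding Suc_eq_plus1 by (metis of_nat_1 of_nat_add of_nat_mult of_nat_numeral)
  then have "int ((N + 1) choose (r + 2)) * ((int r + 2) * (int r + 1))
      = (int N + 1) * ((int r + 1) * int (N choose Suc r))"
    by (metis mult.assoc mult.commute)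
  then show ?thesis unfolding binomial_lower_step by (simp only: mult.assoc)
qed

text \<open>This is the relation for \<open>n = 4 m\<close> and \<open>k = 2 (j + 1)\<close>, where
\<open>n\<^sup>2 - (2 k - 4)\<^sup>2 = 16 (m\<^sup>2 - j\<^sup>2)\<close>, with the denominator cleared. Raising \<open>j\<close>
by one multiplies the two binomial coefficients \<open>X\<close> and \<open>Y\<close> by different factors, and
\<open>(m + j) Y = (m - j) X\<close> shows that their sum is multiplied by \<open>m\<^sup>2 - j\<^sup>2\<close>, up to the
denominator.\<close>
lemma phi_coeff_rec:
  assumes "j < m"
  shows "phi_coeff m (Suc j) * ((2 * int j + 2) * (2 * int j + 1))
    = - 16 * (int m ^ 2 - int j ^ 2) * phi_coeff m j"
proof -
  obtain k where m: "m = Suc k" using assms by (cases m) auto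
  define X where "X = int ((m + j) choose (2 * j))"
  define Y where "Y = int ((k + j) choose (2 * j))"
  have "int ((m + j + 1) choose (2 * j + 2)) * ((2 * int j + 2) * (2 * int j + 1))
      = (int m + int j + 1) * (int m - int j) * X"
    using binomial_step[of "m + j" "2 * j"] by (simp add: X_def algebra_simps)
  moreover have "int ((m + j) choose (2 * j + 2)) * ((2 * int j + 2) * (2 * int j + 1))
      = (int m + int j) * (int m - int j - 1) * Y"
    using binomial_step[of "k + j" "2 * j"] by (simp add: Y_def m algebra_simps)
  moreover have "(int m + int j) * Y = (int m - int j) * X"
  proof -
    have "Y = int ((m + j - 1) choose (2 * j))" by (simp add: Y_def m)
    then have "int (m + j - 2 * j) * X = int (m + j) * Y"
      unfolding X_def by (simp only: of_nat_mult[symmetric] binomial_absorb_comp)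
    then show ?thesis using assms by (simp add: of_nat_diff)
  qed
  ultimately have P: "(int ((m + j + 1) choose (2 * j + 2)) + int ((m + j) choose (2 * j + 2)))
      * ((2 * int j + 2) * (2 * int j + 1)) = (int m ^ 2 - int j ^ 2) * (X + Y)"
    (is "?P * ?D = _")
    unfolding distrib_right[of _ _ ?D] by (simp only:) (simp add: algebra_simps power2_eq_square)
  have phi_j: "phi_coeff m j = (-16) ^ j * (X + Y)"
    by (simp add: phi_coeff_def X_def Y_def m)
  have "phi_coeff m (Suc j) = -16 * (-16) ^ j * ?P"
    by (simp add: phi_coeff_def del: binomial_Suc_Suc)
  then have "phi_coeff m (Suc j) * ?D = -16 * (-16) ^ j * (?P * ?D)"
    by (simp only: mult.assoc)
  also have "\<dots> = - 16 * (int m ^ 2 - int j ^ 2) * phi_coeff m j"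
    unfolding P phi_j by (simp only: mult_ac)
  finally show ?thesis .
qed

lemma phi_indices_4: "phi_indices (4 * m) = (\<lambda>j. 2 * j) ` {..m}"
  by (auto simp: phi_indices_def elim!: evenE)

text \<open>The quotients prescribed by the relation are nonzero, which excludes the default value of a division by
\<open>0\<close>. Hence every value is determined by the preceding one, and the solution is the multiple of
\<open>phi_coeff\<close> with the given value at \<open>0\<close>.\<close>
lemma phi_relation_imp_phi_coeff:
  assumes "phi_relation (4 * m) \<phi>" "j \<le> m"
  shows "\<phi> (2 * j) = \<phi> 0 / 2 * of_int (phi_coeff m j)"
  using \<open>j \<le> m\<close>
proof (induction j)
  case (Suc j)
  define D :: rat where "D = (2 * of_nat j + 2) * (2 * of_nat j + 1)"
  define E :: rat where "E = - 16 * (of_nat m ^ 2 - of_nat j ^ 2)"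
  have "D \<noteq> 0"
  proof -
    have "D = of_nat ((2 * j + 2) * (2 * j + 1))"
      by (simp only: D_def of_nat_mult of_nat_add of_nat_numeral of_nat_1)
    then show ?thesis by (simp only: of_nat_eq_0_iff) simp
  qed
  have "E \<noteq> 0"
    using Suc.prems by (simp add: E_def flip: of_nat_power)
  have "2 * Suc j \<in> phi_indices (4 * m)" using Suc.prems by (simp add: phi_indices_def)
  then have "\<phi> (2 * Suc j) / \<phi> (2 * Suc j - 2)
      = - (((of_nat (4 * m))\<^sup>2 - (2 * of_nat (2 * Suc j) - 4)\<^sup>2)
          / (of_nat (2 * Suc j) * (of_nat (2 * Suc j) - 1)))"
    using assms(1)[unfolded phi_relation_def, rule_format, of "2 * Suc j"] by simp
  moreover have "of_nat (2 * Suc j) * (of_nat (2 * Suc j) - 1) = D"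
    by (simp add: D_def algebra_simps)
  moreover have "(of_nat (4 * m))\<^sup>2 - (2 * of_nat (2 * Suc j) - 4)\<^sup>2 = - E"
    by (simp add: E_def algebra_simps power2_eq_square)
  ultimately have "\<phi> (2 * Suc j) / \<phi> (2 * j) = E / D" by simp
  then have "\<phi> (2 * Suc j) = E / D * \<phi> (2 * j)"
    using \<open>D \<noteq> 0\<close> \<open>E \<noteq> 0\<close> by (cases "\<phi> (2 * j) = 0") (auto simp: field_simps)
  moreover have "of_int (phi_coeff m (Suc j)) = E / D * of_int (phi_coeff m j)"
    using arg_cong[OF phi_coeff_rec[of j m], of "of_int :: int \<Rightarrow> rat"] Suc.prems
      \<open>D \<noteq> 0\<close> by (simp add: D_def E_def nonzero_eq_divide_eq)
  moreover have "\<phi> (2 * j) = \<phi> 0 / 2 * of_int (phi_coeff m j)" using Suc by simp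
  ultimately show ?case by (simp only: mult_ac)
qed simp

text \<open>For \<open>x = -16\<close> the two roots must have the sum \<open>2 + x = -14\<close>, which is the sum of
\<open>-w\<^sup>2 = -(7 + 4 \<surd>3)\<close> and \<open>-w'\<^sup>2 = -(7 - 4 \<surd>3)\<close>. The signs disappear because
\<open>m\<close> is even.\<close>
lemma sum_phi_coeff_zsqrt3:
  assumes "m > 0" "even m"
  shows "(of_int (\<Sum>j\<le>m. phi_coeff m j) :: zsqrt3) = unit_w ^ (2 * m) + unit_w' ^ (2 * m)"
proof -
  obtain k where m: "m = Suc k" using assms by (cases m) auto
  have "- (unit_w ^ 2) * - (unit_w' ^ 2) = 1"
    using unit_w_power_mult[of 2] by simp
  moreover have "- (unit_w ^ 2) + - (unit_w' ^ 2) = 2 + of_int (-16)"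
    unfolding zsqrt3_eq_iff plus_zsqrt3.simps parts_of_int
    by (simp add: power2_eq_square unit_w_def unit_w'_def two_parts)
  ultimately have "of_int (\<Sum>j\<le>m. phi_coeff m j) = (- (unit_w ^ 2)) ^ m + (- (unit_w' ^ 2)) ^ m"
    using morgan_voyce_add_eq_power_sum[of "- (unit_w ^ 2)" "- (unit_w' ^ 2)" "of_int (-16)" k]
    unfolding m sum_phi_coeff of_int_add of_int_morgan_voyce by simp
  then show ?thesis using \<open>even m\<close> by (simp add: power_mult)
qed

theorem theorem5:
  fixes p n :: nat and \<phi> :: "nat \<Rightarrow> rat"
  assumes "prime p" and "p \<ge> 5" and "n = 2 ^ (p - 1)"
    and "phi_relation n \<phi>"
    and "\<phi> 0 = 2 \<or> \<phi> (n div 2) = 4 ^ (n div 2)"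
  shows "(\<phi> 0 = 2 \<and> \<phi> (n div 2) = 4 ^ (n div 2)) \<and>
    (\<forall>k\<in>phi_indices n. \<phi> k \<in> \<int>) \<and>
    (prime (2 ^ p - 1 :: nat) \<longleftrightarrow>
      (\<exists>s::int. (\<Sum>k\<in>phi_indices n. \<phi> k) = of_int s \<and> 2 * int n - 1 dvd s))"
proof -
  define m :: nat where "m = 2 ^ (p - 3)"
  obtain e where p: "p = e + 4" using \<open>p \<ge> 5\<close> le_Suc_ex[of 4 p] by (auto simp: add.commute)
  have m: "m > 0" "even m" "n = 4 * m" "2 ^ (p - 2) = 2 * m" "2 * int n - 1 = 2 ^ p - 1"
    unfolding m_def \<open>n = _\<close> p by (simp_all add: power_add)
  have "odd p" using \<open>prime p\<close> \<open>p \<ge> 5\<close> prime_odd_nat by auto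
  have scaled: "\<phi> (2 * j) = \<phi> 0 / 2 * of_int (phi_coeff m j)" if "j \<le> m" for j
    using phi_relation_imp_phi_coeff[OF _ that] assms(4) unfolding m by blast
  have "n div 2 = 2 * m" unfolding m by simp
  \<comment> \<open>At the two ends the coefficients are \<open>2\<close> and \<open>4 ^ (n div 2)\<close>, so either starting value fixes the scalar.\<close>
  have top: "\<phi> (n div 2) = \<phi> 0 / 2 * 4 ^ (n div 2)"
    unfolding \<open>n div 2 = 2 * m\<close> using scaled[of m] phi_coeff_top[OF m(1,2)]
    by (simp add: power_mult)
  then have "\<phi> 0 = 2" using assms(5) by auto
  then have phi: "\<phi> (2 * j) = of_int (phi_coeff m j)" if "j \<le> m" for j
    using scaled[OF that] by simp
  have "(\<Sum>k\<in>phi_indices n. \<phi> k) = (\<Sum>j\<le>m. \<phi> (2 * j))"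
    unfolding m phi_indices_4 by (simp add: sum.reindex inj_on_def)
  then have "(\<Sum>k\<in>phi_indices n. \<phi> k) = of_int (\<Sum>j\<le>m. phi_coeff m j)"
    by (simp add: phi)
  moreover have "prime (2 ^ p - 1 :: nat) \<longleftrightarrow> 2 * int n - 1 dvd (\<Sum>j\<le>m. phi_coeff m j)"
  proof -
    have "prime (2 ^ p - 1 :: nat) \<longleftrightarrow>
        (of_int (2 ^ p - 1) :: zsqrt3) dvd of_int (\<Sum>j\<le>m. phi_coeff m j)"
      using lucas_lehmer[OF \<open>odd p\<close>] \<open>p \<ge> 5\<close> sum_phi_coeff_zsqrt3[OF m(1,2)] m(4) by simp
    then show ?thesis unfolding of_int_dvd_of_int_zsqrt3_iff m(5) .
  qed
  moreover have "\<forall>k\<in>phi_indices n. \<phi> k \<in> \<int>"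
    unfolding m phi_indices_4 by (simp add: phi)
  ultimately show ?thesis using \<open>\<phi> 0 = 2\<close> top by (simp only: of_int_eq_iff) auto
qed

end
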